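(* Let $\mathfrak{S}$ be a finite subset of $\mathbb{Z}^2$ and let $(H,\rho)$ be a Gessel pair with $H\subseteq\mathfrak{S}^*$, with sets of minus-, zero- and plus-paths $H_-$, $H_0$, $H_+$. For $P\subseteq H$ put $\Gamma(P)=\sum_{\pi\in P} x^{a(\pi)}y^{b(\pi)}t^{\ell(\pi)}z^{\rho(\pi)}$, where $(a(\pi),b(\pi))$ is the ending point and $\ell(\pi)$ the length of $\pi$. Then $$\Gamma(H_-)=[\Gamma(H)]_-,\qquad \Gamma(H_0)=[\Gamma(H)]_0,\qquad \Gamma(H_+)=[\Gamma(H)]_+,$$ where $\Gamma(H)=[\Gamma(H)]_-[\Gamma(H)]_0[\Gamma(H)]_+$ is the unique factorization of $\Gamma(H)$ with respect to $z$.
   Context: A path is a finite sequence of lattice points $(a_0,b_0),\dots,(a_n,b_n)$ in $\mathbb{Z}^2$ with $(a_0,b_0)=(0,0)$; its steps are $(a_i-a_{i-1},b_i-b_{i-1})$, $n$ is its length and $(a_n,b_n)$ its ending point. $\mathfrak{S}^*$ denotes the set of paths all of whose steps lie in $\mathfrak{S}$. The product of two paths is concatenation of their step sequences; the empty path $\varepsilon$ is the unit. A monoid is free if every element factors uniquely as a product of primes. A Gessel pair $(H,\rho)$ consists of a subset $H\subseteq\mathfrak{S}^*$ which is a free monoid under concatenation, together with a homomorphism $\rho:H\to\mathbb{Z}$. For $\sigma\in H$ with prime factorization $\sigma=h_1\cdots h_m$ in $H$, its $H$-heads are $h_1\cdots h_i$, $i=0,\dots,m$. A minus-path is an element of $H$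 that is either empty or has negative $\rho$ value strictly less than the $\rho$ values of all its other $H$-heads; a zero-path is an element of $H$ with $\rho$ value $0$ all of whose $H$-heads have nonnegative $\rho$ values; a plus-path is an element of $H$ all of whose nonempty $H$-heads have positive $\rho$ values. $H_-,H_0,H_+$ denote the sets of minus-, zero- and plus-paths. The series $\Gamma(P)$ lie in the field $K\langle\langle x,y,z,t\rangle\rangle$ of iterated Laurent series ($K=\mathbb{C}$), defined inductively as Laurent series in $t$ with coefficients in $K\langle\langle x,y,z\rangle\rangle$, etc.; elements have well-ordered support in reverse lexicographic order and an initial term (term of minimal order). Unique factorization with respect to $z$: every $h$ in this field with initial term $1$ can be written uniquely as $h=h_-h_0h_+$ with $h_-,h_0,h_+$ in the field, each with initial term $1$, such that apart from the initial term $h_-$ contains only negative powers of $z$, $h_0$ is independent of $z$, and $h_+$ contains only positive powers of $z$; these factors are denoted $[h]_-,[h]_0,[h]_+$. *)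

theory Defs
  imports Complex_Main "HOL-Library.Product_Plus"
    "HOL-Computational_Algebra.Formal_Laurent_Series"
begin

section \<open>Lattice paths\<close>

text \<open>
  A path starts at the origin, so it is determined by its list of steps, and we represent it by
  that list.  The length of the path is the length of the list, the product of paths is
  \<open>@\<close>, the empty path is \<open>[]\<close>, and the paths with all steps in \<open>S\<close> form the set \<open>lists S\<close>.
  Lemma \<open>bij_betw_vertices\<close> below records that passing to the sequence of
  visited lattice points is a bijection.
\<close>

type_synonym path = "(int \<times> int) list"

definition ending_point :: "path \<Rightarrow> int \<times> int" where
  "ending_point \<pi> = sum_list \<pi>"

definition vertices :: "path \<Rightarrow> (int \<times> int) list" where
  "vertices \<pi> = map (\<lambda>i. sum_list (take i \<pi>)) [0..<Suc (length \<pi>)]"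

lemma length_vertices: "length (vertices \<pi>) = Suc (length \<pi>)"
  by (simp add: vertices_def)

lemma last_vertices: "last (vertices \<pi>) = ending_point \<pi>"
  by (simp add: vertices_def ending_point_def)

lemma nth_vertices: "i \<le> length \<pi> \<Longrightarrow> vertices \<pi> ! i = sum_list (take i \<pi>)"
  by (simp add: vertices_def del: upt_Suc)

lemma vertices_step:
  assumes "i < length \<pi>"
  shows "vertices \<pi> ! Suc i - vertices \<pi> ! i = \<pi> ! i"
  using assms by (simp add: nth_vertices take_Suc_conv_app_nth)

lemma bij_betw_vertices:
  "bij_betw vertices (lists S)
     {ps. ps \<noteq> [] \<and> hd ps = (0, 0) \<and> (\<forall>i < length ps - 1. ps ! Suc i - ps ! i \<in> S)}"
    (is "bij_betw _ _ ?V")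
proof (rule bij_betw_imageI)
  show "inj_on vertices (lists S)"
  proof (rule inj_onI)
    fix p q assume eq: "vertices p = vertices q"
    then have len: "length p = length q"
      by (metis length_vertices nat.inject)
    show "p = q"
      by (rule nth_equalityI[OF len]) (metis eq len vertices_step)
  qed
  show "vertices ` lists S = ?V"
  proof (intro equalityI subsetI)
    fix ps assume "ps \<in> vertices ` lists S"
    then obtain p where p: "p \<in> lists S" "ps = vertices p" by blast
    have "ps \<noteq> []" using p length_vertices[of p] by auto
    moreover have "hd ps = (0, 0)"
      using p \<open>ps \<noteq> []\<close> nth_vertices[of 0 p] by (simp add: hd_conv_nth zero_prod_def)
    moreover have "\<forall>i < length ps - 1. ps ! Suc i - ps ! i \<in> S"
      using p by (auto simp: length_vertices vertices_step)
    ultimately show "ps \<in> ?V" by blast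
  next
    fix ps assume ps: "ps \<in> ?V"
    define p where "p = map (\<lambda>i. ps ! Suc i - ps ! i) [0..<length ps - 1]"
    have lp: "length p = length ps - 1" by (simp add: p_def)
    have len: "length (vertices p) = length ps"
      using ps lp by (simp add: length_vertices)
    have nth: "vertices p ! i = ps ! i" if "i < length ps" for i
      using that
    proof (induction i)
      case 0
      then show ?case using ps by (simp add: nth_vertices hd_conv_nth zero_prod_def)
    next
      case (Suc i)
      then have i: "i < length p" using lp by simp
      have "vertices p ! Suc i = vertices p ! i + p ! i"
        using vertices_step[OF i] by (metis add.commute diff_add_cancel)
      also have "\<dots> = ps ! Suc i" using Suc i lp by (simp add: p_def)
      finally show ?case .
    qed
    have "vertices p = ps" using len nth by (simp add: nth_equalityI)
    moreover have "p \<in> lists S" using ps by (auto simp: p_def)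
    ultimately show "ps \<in> vertices ` lists S" by blast
  qed
qed

section \<open>Gessel pairs\<close>

definition prime_paths :: "path set \<Rightarrow> path set" where
  "prime_paths H = {p \<in> H. p \<noteq> [] \<and> (\<forall>u\<in>H. \<forall>v\<in>H. p = u @ v \<longrightarrow> u = [] \<or> v = [])}"

definition is_prime_factorization :: "path set \<Rightarrow> path \<Rightarrow> path list \<Rightarrow> bool" where
  "is_prime_factorization H \<sigma> hs \<longleftrightarrow> set hs \<subseteq> prime_paths H \<and> concat hs = \<sigma>"

definition free_monoid :: "path set \<Rightarrow> bool" where
  "free_monoid H \<longleftrightarrow>
     [] \<in> H \<and> (\<forall>u\<in>H. \<forall>v\<in>H. u @ v \<in> H) \<and>
     (\<forall>\<sigma>\<in>H. \<exists>!hs. is_prime_factorization H \<sigma> hs)"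

definition gessel_pair :: "(int \<times> int) set \<Rightarrow> path set \<Rightarrow> (path \<Rightarrow> int) \<Rightarrow> bool" where
  "gessel_pair S H \<rho> \<longleftrightarrow>
     H \<subseteq> lists S \<and> free_monoid H \<and> (\<forall>u\<in>H. \<forall>v\<in>H. \<rho> (u @ v) = \<rho> u + \<rho> v)"

definition H_factorization :: "path set \<Rightarrow> path \<Rightarrow> path list" where
  "H_factorization H \<sigma> = (THE hs. is_prime_factorization H \<sigma> hs)"

definition heads :: "path set \<Rightarrow> path \<Rightarrow> path set" where
  "heads H \<sigma> =
     {concat (take i (H_factorization H \<sigma>)) | i. i \<le> length (H_factorization H \<sigma>)}"

definition minus_paths :: "path set \<Rightarrow> (path \<Rightarrow> int) \<Rightarrow> path set" where
  "minus_paths H \<rho> =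
     {\<sigma> \<in> H. \<sigma> = [] \<or> (\<rho> \<sigma> < 0 \<and> (\<forall>\<tau> \<in> heads H \<sigma> - {\<sigma>}. \<rho> \<sigma> < \<rho> \<tau>))}"

definition zero_paths :: "path set \<Rightarrow> (path \<Rightarrow> int) \<Rightarrow> path set" where
  "zero_paths H \<rho> = {\<sigma> \<in> H. \<rho> \<sigma> = 0 \<and> (\<forall>\<tau> \<in> heads H \<sigma>. 0 \<le> \<rho> \<tau>)}"

definition plus_paths :: "path set \<Rightarrow> (path \<Rightarrow> int) \<Rightarrow> path set" where
  "plus_paths H \<rho> = {\<sigma> \<in> H. \<forall>\<tau> \<in> heads H \<sigma>. \<tau> \<noteq> [] \<longrightarrow> 0 < \<rho> \<tau>}"

section \<open>Iterated Laurent series\<close>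

text \<open>
  The innermost variable is \<open>x\<close> and the outermost is \<open>t\<close>: \<open>xyz_series\<close> is the field of Laurent
  series in \<open>z\<close> over the Laurent series in \<open>y\<close> over the Laurent series in \<open>x\<close>, and
  \<open>xyzt_series\<close> is the field of Laurent series in \<open>t\<close> over \<open>xyz_series\<close>.
  The quadruple \<open>(i, j, k, l)\<close> is the exponent of \<open>x\<^sup>i y\<^sup>j z\<^sup>k t\<^sup>l\<close>.
\<close>

type_synonym xyz_series = "complex fls fls fls"
type_synonym xyzt_series = "xyz_series fls"
type_synonym exponent = "int \<times> int \<times> int \<times> int"

definition var_x :: xyz_series where "var_x = fls_const (fls_const fls_X)"
definition var_y :: xyz_series where "var_y = fls_const fls_X"
definition var_z :: xyz_series where "var_z = fls_X"
definition var_t :: xyzt_series where "var_t = fls_X"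

fun monomial :: "complex \<Rightarrow> exponent \<Rightarrow> xyzt_series" where
  "monomial c (i, j, k, l) =
     fls_const (fls_const (fls_const (fls_const c)) * var_x powi i * var_y powi j * var_z powi k)
       * var_t powi l"

fun series_coeff :: "xyzt_series \<Rightarrow> exponent \<Rightarrow> complex" where
  "series_coeff h (i, j, k, l) = fls_nth (fls_nth (fls_nth (fls_nth h l) k) j) i"

definition support :: "xyzt_series \<Rightarrow> exponent set" where
  "support h = {e. series_coeff h e \<noteq> 0}"

fun z_exponent :: "exponent \<Rightarrow> int" where
  "z_exponent (i, j, k, l) = k"

fun revlex_le :: "exponent \<Rightarrow> exponent \<Rightarrow> bool" where
  "revlex_le (i, j, k, l) (i', j', k', l') \<longleftrightarrow>
     l < l' \<or> (l = l' \<and> (k < k' \<or> (k = k' \<and> (j < j' \<or> (j = j' \<and> i \<le> i')))))"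

definition has_initial_exponent :: "xyzt_series \<Rightarrow> exponent \<Rightarrow> bool" where
  "has_initial_exponent h e \<longleftrightarrow> e \<in> support h \<and> (\<forall>e' \<in> support h. revlex_le e e')"

definition has_initial_term :: "xyzt_series \<Rightarrow> xyzt_series \<Rightarrow> bool" where
  "has_initial_term h T \<longleftrightarrow> (\<exists>e. has_initial_exponent h e \<and> T = monomial (series_coeff h e) e)"

text \<open>When the initial term is \<open>1\<close>, the non-initial terms of \<open>h\<close> are the terms of \<open>h - 1\<close>.\<close>

definition is_z_factorization ::
    "xyzt_series \<Rightarrow> xyzt_series \<times> xyzt_series \<times> xyzt_series \<Rightarrow> bool" where
  "is_z_factorization h = (\<lambda>(h_minus, h_zero, h_plus).
     h = h_minus * h_zero * h_plus \<and>
     has_initial_term h_minus 1 \<and> has_initial_term h_zero 1 \<and> has_initial_term h_plus 1 \<and>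
     (\<forall>e \<in> support (h_minus - 1). z_exponent e < 0) \<and>
     (\<forall>e \<in> support h_zero. z_exponent e = 0) \<and>
     (\<forall>e \<in> support (h_plus - 1). 0 < z_exponent e))"

definition z_factorization ::
    "xyzt_series \<Rightarrow> xyzt_series \<times> xyzt_series \<times> xyzt_series" where
  "z_factorization h = (THE f. is_z_factorization h f)"

definition minus_factor :: "xyzt_series \<Rightarrow> xyzt_series" where
  "minus_factor h = fst (z_factorization h)"

definition zero_factor :: "xyzt_series \<Rightarrow> xyzt_series" where
  "zero_factor h = fst (snd (z_factorization h))"

definition plus_factor :: "xyzt_series \<Rightarrow> xyzt_series" where
  "plus_factor h = snd (snd (z_factorization h))"

section \<open>Generating functions\<close>

text \<open>
  The infinite sum of \<open>x\<^sup>a y\<^sup>b t\<^sup>n z\<^sup>\<rho>\<close> over \<open>P\<close> is formed by collecting the paths of length \<open>n\<close> in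
  the coefficient of \<open>t\<^sup>n\<close>; that coefficient is a finite sum if the step set is finite.
  Lemma \<open>coeff_generating_function\<close> below gives the individual coefficients.
\<close>

definition generating_function :: "(path \<Rightarrow> int) \<Rightarrow> path set \<Rightarrow> xyzt_series" where
  "generating_function \<rho> P = fps_to_fls (Abs_fps (\<lambda>n.
     \<Sum>\<pi> \<in> {\<pi> \<in> P. length \<pi> = n}.
       var_x powi fst (ending_point \<pi>) * var_y powi snd (ending_point \<pi>) * var_z powi \<rho> \<pi>))"

lemma fls_const_power_int: "fls_const (c :: 'a :: field) powi n = fls_const (c powi n)"
  by (simp add: power_int_def fls_const_power fls_inverse_const)

lemma nth_times_fls_X_powi:
  "fls_nth (f * fls_X powi n) m = fls_nth (f :: 'a :: field fls) (m - n)"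
  by (simp add: fls_X_intpow_times_conv_shift)

lemma nth_xyz_monomial:
  "fls_nth (fls_nth (fls_nth (fls_const (fls_const (fls_const c)) *
       var_x powi i * var_y powi j * var_z powi k) k') j') i' =
     (if i' = i \<and> j' = j \<and> k' = k then c else 0)"
  by (simp add: var_x_def var_y_def var_z_def fls_const_power_int nth_times_fls_X_powi
      fls_X_intpow_times_conv_shift fls_const_mult_const del: fls_X_power_int
      flip: fls_const_mult_const)

lemma coeff_monomial: "series_coeff (monomial c e) e' = (if e' = e then c else 0)"
  by (cases e; cases e')
    (auto simp: nth_xyz_monomial nth_times_fls_X_powi var_t_def simp del: fls_X_power_int)

lemma finite_paths_of_length:
  assumes "finite S" "P \<subseteq> lists S"
  shows "finite {\<pi> \<in> P. length \<pi> = n}"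
  by (rule finite_subset[OF _ finite_lists_length_eq[OF assms(1), of n]]) (use assms in auto)

lemma coeff_generating_function:
  assumes "finite S" "P \<subseteq> lists S"
  shows "series_coeff (generating_function \<rho> P) (i, j, k, l) =
    of_nat (card {\<pi> \<in> P. ending_point \<pi> = (i, j) \<and> \<rho> \<pi> = k \<and> int (length \<pi>) = l})"
proof (cases "l < 0")
  case True
  then show ?thesis by (auto simp: generating_function_def)
next
  case False
  define A where "A = {\<pi> \<in> P. length \<pi> = nat l}"
  have fin: "finite A" unfolding A_def using assms by (rule finite_paths_of_length)
  have "series_coeff (generating_function \<rho> P) (i, j, k, l) =
     (\<Sum>\<pi>\<in>A. if ending_point \<pi> = (i, j) \<and> \<rho> \<pi> = k then 1 else 0)"
    using False nth_xyz_monomial[of 1]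
    by (auto simp: generating_function_def fls_nth_sum A_def prod_eq_iff intro!: sum.cong)
  also have "\<dots> = of_nat (card {\<pi> \<in> A. ending_point \<pi> = (i, j) \<and> \<rho> \<pi> = k})"
    using fin by (simp add: sum.If_cases Int_def)
  also have "{\<pi> \<in> A. ending_point \<pi> = (i, j) \<and> \<rho> \<pi> = k} =
      {\<pi> \<in> P. ending_point \<pi> = (i, j) \<and> \<rho> \<pi> = k \<and> int (length \<pi>) = l}"
    using False by (auto simp: A_def)
  finally show ?thesis .
qed

end

theory Submission
  imports Defs "HOL-Library.Sublist"
begin

text \<open>
  Cutting the \<open>\<rho>\<close>-walk of a path first at the earliest head where it attains its minimum, and then
  at the last head where it returns to that minimum, writes the path uniquely as a product of a
  minus-, a zero- and a plus-path.  As weights are multiplicative,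
  \<open>\<Gamma>(H) = \<Gamma>(H\<^sub>-) \<Gamma>(H\<^sub>0) \<Gamma>(H\<^sub>+)\<close>, and this factorization has the form required in the
  unique factorization with respect to \<open>z\<close>.

  Uniqueness of such a factorization follows by induction on the degree in \<open>t\<close>.  If
  \<open>m P = m' P'\<close>, where \<open>m\<close>, \<open>m'\<close> are minus-factors and \<open>P\<close>, \<open>P'\<close> have no negative powers of \<open>z\<close>,
  and if the coefficients agree below \<open>t\<^sup>n\<close>, then \<open>P\<^sub>n - P'\<^sub>n = (m'\<^sub>n - m\<^sub>n) P\<^sub>0\<close>.  Here the left
  side has no negative powers of \<open>z\<close>, whereas the right side, unless it vanishes, starts with a
  negative one, because \<open>P\<^sub>0\<close> has order \<open>0\<close> in \<open>z\<close>.
\<close>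

section \<open>Uniqueness of the factorization\<close>

text \<open>Both factors are embedded power series, and for these the constant coefficient is
  multiplicative.\<close>

lemma fls_mult_nth_below_zero:
  fixes f g :: "'k::field fls"
  assumes "\<And>k. k < 0 \<Longrightarrow> fls_nth f k = 0" "\<And>k. k < 0 \<Longrightarrow> fls_nth g k = 0"
  shows "k < 0 \<Longrightarrow> fls_nth (f * g) k = 0" "fls_nth (f * g) 0 = fls_nth f 0 * fls_nth g 0"
proof -
  have f: "f = fps_to_fls (fls_regpart f)" and g: "g = fps_to_fls (fls_regpart g)"
    using assms by (auto intro!: fls_eqI)
  have fg: "f * g = fps_to_fls (fls_regpart f * fls_regpart g)"
    using f g by (metis fls_times_fps_to_fls)
  show "k < 0 \<Longrightarrow> fls_nth (f * g) k = 0" unfolding fg by simp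
  show "fls_nth (f * g) 0 = fls_nth f 0 * fls_nth g 0" unfolding fg by simp
qed

text \<open>The power series variable plays the role of \<open>t\<close>, the Laurent variable that
  of \<open>z\<close>. In degree \<open>n\<close> the only unknowns are the top coefficients, and
  the sign of the \<open>z\<close>-exponents separates them.\<close>

lemma fps_fls_factorization_unique:
  fixes m m' P P' :: "'k::field fls fps"
  assumes eq: "m * P = m' * P'"
    and m0: "fps_nth m 0 = 1" "fps_nth m' 0 = 1"
    and m: "\<And>n k. 0 < n \<Longrightarrow> 0 \<le> k \<Longrightarrow> fls_nth (fps_nth m n) k = 0"
    and m': "\<And>n k. 0 < n \<Longrightarrow> 0 \<le> k \<Longrightarrow> fls_nth (fps_nth m' n) k = 0"
    and P: "\<And>n k. k < 0 \<Longrightarrow> fls_nth (fps_nth P n) k = 0"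
    and P': "\<And>n k. k < 0 \<Longrightarrow> fls_nth (fps_nth P' n) k = 0"
    and P0: "fls_nth (fps_nth P 0) 0 \<noteq> 0"
  shows "m = m' \<and> P = P'"
proof -
  have PP0: "fps_nth P 0 = fps_nth P' 0"
    using arg_cong[OF eq, of "\<lambda>f. fps_nth f 0"] m0 by simp
  have "fps_nth m n = fps_nth m' n \<and> fps_nth P n = fps_nth P' n" for n
  proof (induction n rule: less_induct)
    case (less n)
    show ?case
    proof (cases "n = 0")
      case True
      then show ?thesis using m0 PP0 by simp
    next
      case False
      \<comment> \<open>\<open>R\<close> collects the terms of the Cauchy product whose two indices
        both lie strictly below \<open>n\<close>; by induction it is the same for both
        factorizations.\<close>
      define R where "R = (\<Sum>i\<in>{0<..<n}. fps_nth m i * fps_nth P (n - i))"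
      have split: "{0..n} = insert 0 (insert n {0<..<n})" using False by auto
      have "fps_nth (m * P) n = fps_nth P n + fps_nth m n * fps_nth P 0 + R"
        using False m0 unfolding fps_mult_nth split R_def by simp
      moreover have "fps_nth (m' * P') n = fps_nth P' n + fps_nth m' n * fps_nth P 0 + R"
      proof -
        have "R = (\<Sum>i\<in>{0<..<n}. fps_nth m' i * fps_nth P' (n - i))"
          unfolding R_def by (rule sum.cong) (use less in auto)
        then show ?thesis
          using False m0 PP0 unfolding fps_mult_nth split by simp
      qed
      ultimately have key: "fps_nth P n - fps_nth P' n = (fps_nth m' n - fps_nth m n) * fps_nth P 0"
        using eq by (simp add: algebra_simps)
      define d where "d = fps_nth m' n - fps_nth m n"
      have "d = 0"
      proof (rule ccontr)
        assume d: "d \<noteq> 0"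
        have "fls_subdegree (fps_nth P 0) = 0"
          by (rule fls_subdegree_eqI) (use P0 P in auto)
        moreover have "fps_nth P 0 \<noteq> 0" using P0 by auto
        ultimately have "fls_subdegree (d * fps_nth P 0) = fls_subdegree d" using d by simp
        moreover have "d * fps_nth P 0 \<noteq> 0" using d \<open>fps_nth P 0 \<noteq> 0\<close> by simp
        ultimately have "fls_nth (d * fps_nth P 0) (fls_subdegree d) \<noteq> 0"
          using nth_fls_subdegree_nonzero by metis
        \<comment> \<open>In positive \<open>t\<close>-degree \<open>m\<close> and \<open>m'\<close>
          contain only negative powers of \<open>z\<close>, so the leading exponent of
          \<open>d\<close> is negative; there the coefficients of \<open>P\<close> and
          \<open>P'\<close> vanish.\<close>
        moreover have "fls_subdegree d < 0"
          using d nth_fls_subdegree_nonzero[OF d] m[of n] m'[of n] False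
          by (metis d_def diff_0_right fls_minus_nth linorder_not_le neq0_conv)
        moreover have "d * fps_nth P 0 = fps_nth P n - fps_nth P' n" using key by (simp only: d_def)
        ultimately show False by (simp add: P P')
      qed
      then show ?thesis using key by (simp add: d_def)
    qed
  qed
  then show ?thesis by (simp add: fps_eq_iff)
qed

text \<open>As \<open>p\<close> is 1 plus positive powers of \<open>z\<close>, the part of
  \<open>c * p\<close> constant in \<open>z\<close> is \<open>c\<close> itself. So the product
  determines \<open>c\<close>, and \<open>p\<close> follows by cancellation.\<close>

lemma fps_fls_constant_factor_unique:
  fixes c p c' p' :: "'k::field fls fps"
  assumes eq: "c * p = c' * p'" and "c \<noteq> 0"
    and c: "\<And>n k. k \<noteq> 0 \<Longrightarrow> fls_nth (fps_nth c n) k = 0"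
    and c': "\<And>n k. k \<noteq> 0 \<Longrightarrow> fls_nth (fps_nth c' n) k = 0"
    and p: "\<And>n k. k \<le> 0 \<Longrightarrow> fls_nth (fps_nth p n) k = fls_nth (fps_nth 1 n) k"
    and p': "\<And>n k. k \<le> 0 \<Longrightarrow> fls_nth (fps_nth p' n) k = fls_nth (fps_nth 1 n) k"
  shows "c = c' \<and> p = p'"
proof -
  have z0: "fls_nth (fps_nth (a * b) n) 0 = fls_nth (fps_nth a n) 0"
    if a: "\<And>n k. k \<noteq> 0 \<Longrightarrow> fls_nth (fps_nth a n) k = 0"
      and b: "\<And>n k. k \<le> 0 \<Longrightarrow> fls_nth (fps_nth b n) k = fls_nth (fps_nth 1 n) k"
    for a b :: "'k fls fps" and n
  proof -
    have "k < 0 \<Longrightarrow> fls_nth (fps_nth b l) k = 0" for l k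
      using b[of k l] by (cases "l = 0") auto
    then have "fls_nth (fps_nth a i * fps_nth b l) 0 = fls_nth (fps_nth a i) 0 * fls_nth (fps_nth b l) 0"
      for i l
      using a by (intro fls_mult_nth_below_zero(2)) auto
    then have "fls_nth (fps_nth (a * b) n) 0 =
        (\<Sum>i=0..n. fls_nth (fps_nth a i) 0 * fls_nth (fps_nth b (n - i)) 0)"
      by (simp add: fps_mult_nth fls_nth_sum)
    \<comment> \<open>The \<open>z\<close>-constant part of \<open>b\<close> is 1 in
      \<open>t\<close>-degree 0 and vanishes in all higher degrees.\<close>
    also have "\<dots> = (\<Sum>i=0..n. if i = n then fls_nth (fps_nth a n) 0 else 0)"
      by (rule sum.cong) (auto simp: b)
    finally show ?thesis by simp
  qed
  have "c = c'"
  proof (rule fps_ext, rule fls_eqI)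
    fix n k
    show "fls_nth (fps_nth c n) k = fls_nth (fps_nth c' n) k"
    proof (cases "k = 0")
      case True
      then show ?thesis using z0[of c p n] z0[of c' p' n] c c' p p' eq by simp
    qed (simp add: c c')
  qed
  then show ?thesis using eq \<open>c \<noteq> 0\<close> by simp
qed

section \<open>From iterated Laurent series to power series in \<open>t\<close>\<close>

lemma series_coeff_one: "series_coeff 1 e = (if e = (0, 0, 0, 0) then 1 else 0)"
proof -
  have "(1 :: xyzt_series) = monomial 1 (0, 0, 0, 0)" by simp
  then show ?thesis by (metis coeff_monomial)
qed

lemma series_coeff_diff: "series_coeff (f - g) e = series_coeff f e - series_coeff g e"
  by (cases e) simp

text \<open>If 1 equals a monomial with nonzero coefficient, then comparing coefficients forces
  exponent 0 and coefficient 1.\<close>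

lemma has_initial_term_one_iff:
  "has_initial_term h 1 \<longleftrightarrow>
     series_coeff h (0, 0, 0, 0) = 1 \<and> (\<forall>e. series_coeff h e \<noteq> 0 \<longrightarrow> revlex_le (0, 0, 0, 0) e)"
  (is "_ \<longleftrightarrow> ?R")
proof
  assume "has_initial_term h 1"
  then obtain e where e: "series_coeff h e \<noteq> 0" "\<forall>e'. series_coeff h e' \<noteq> 0 \<longrightarrow> revlex_le e e'"
    and one: "1 = monomial (series_coeff h e) e"
    by (auto simp: has_initial_term_def has_initial_exponent_def support_def)
  have "series_coeff 1 e = series_coeff h e" by (subst one) (simp add: coeff_monomial)
  then have "e = (0, 0, 0, 0)" "series_coeff h e = 1"
    using e(1) by (auto simp: series_coeff_one split: if_splits)
  then show ?R using e by simp
next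
  assume R: ?R
  then have "has_initial_exponent h (0, 0, 0, 0)"
    by (auto simp: has_initial_exponent_def support_def)
  then show "has_initial_term h 1"
    unfolding has_initial_term_def using R by (intro exI[of _ "(0, 0, 0, 0)"]) simp
qed

text \<open>The order compares \<open>t\<close>-exponents first and \<open>z\<close>-exponents next.
  Hence no negative power of \<open>t\<close> occurs, and no negative power of \<open>z\<close> in
  \<open>t\<close>-degree 0.\<close>

lemma initial_term_one_fps:
  assumes "has_initial_term h 1"
  shows "h = fps_to_fls (fls_regpart h)" "k < 0 \<Longrightarrow> fls_nth (fls_nth h 0) k = 0"
    "fls_nth (fls_nth h 0) 0 \<noteq> 0"
proof -
  have R: "series_coeff h (0, 0, 0, 0) = 1"
    "\<forall>e. series_coeff h e \<noteq> 0 \<longrightarrow> revlex_le (0, 0, 0, 0) e"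
    using assms unfolding has_initial_term_one_iff by blast+
  have z: "fls_nth (fls_nth (fls_nth (fls_nth h l) k) j) i = 0" if "l < 0 \<or> l = 0 \<and> k < 0" for i j k l
    using spec[OF R(2), of "(i, j, k, l)"] that by auto
  show "h = fps_to_fls (fls_regpart h)"
  proof (rule fls_eqI)
    fix l
    have "fls_nth h l = 0" if "l < 0"
      by (intro fls_eqI) (simp add: z that)
    then show "fls_nth h l = fls_nth (fps_to_fls (fls_regpart h)) l" by simp
  qed
  show "fls_nth (fls_nth h 0) k = 0" if "k < 0"
    by (intro fls_eqI) (simp add: z that)
  show "fls_nth (fls_nth h 0) 0 \<noteq> 0" using R(1) by auto
qed

text \<open>The coefficient of a power of \<open>z\<close> and a power of \<open>t\<close> is itself
  a series in \<open>x\<close> and \<open>y\<close>. Conditions on the \<open>z\<close>-exponents in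
  a support thus become equations between such coefficients.\<close>

lemma fls_nth_nth_eq_if_no_support:
  assumes "\<And>i j. (i, j, k, l) \<notin> support (f - g)"
  shows "fls_nth (fls_nth f l) k = fls_nth (fls_nth g l) k"
  by (intro fls_eqI) (use assms in \<open>simp add: support_def\<close>)

text \<open>Two stages: first the minus-factor is separated from the product of the other two, then
  the zero-factor from the plus-factor.\<close>

lemma z_factorization_unique:
  assumes f: "is_z_factorization h f" and f': "is_z_factorization h f'"
  shows "f = f'"
proof -
  obtain a c p where fe: "f = (a, c, p)" by (cases f)
  obtain a' c' p' where fe': "f' = (a', c', p')" by (cases f')
  define A C Q where "A = fls_regpart a" and "C = fls_regpart c" and "Q = fls_regpart p"
  define A' C' Q' where "A' = fls_regpart a'" and "C' = fls_regpart c'" and "Q' = fls_regpart p'"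
  have F: "h = a * c * p"
    "has_initial_term a 1" "has_initial_term c 1" "has_initial_term p 1"
    "\<forall>e \<in> support (a - 1). z_exponent e < 0" "\<forall>e \<in> support c. z_exponent e = 0"
    "\<forall>e \<in> support (p - 1). 0 < z_exponent e"
    using f unfolding fe is_z_factorization_def by blast+
  have F': "h = a' * c' * p'"
    "has_initial_term a' 1" "has_initial_term c' 1" "has_initial_term p' 1"
    "\<forall>e \<in> support (a' - 1). z_exponent e < 0" "\<forall>e \<in> support c'. z_exponent e = 0"
    "\<forall>e \<in> support (p' - 1). 0 < z_exponent e"
    using f' unfolding fe' is_z_factorization_def by blast+
  have minus_nth: "k \<ge> 0 \<Longrightarrow> fls_nth (fls_nth b l) k = fls_nth (fls_nth 1 l) k"
    if "\<forall>e \<in> support (b - 1). z_exponent e < 0" for b :: xyzt_series and k l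
    by (rule fls_nth_nth_eq_if_no_support) (use that in force)
  have plus_nth: "k \<le> 0 \<Longrightarrow> fls_nth (fls_nth b l) k = fls_nth (fls_nth 1 l) k"
    if "\<forall>e \<in> support (b - 1). 0 < z_exponent e" for b :: xyzt_series and k l
    by (rule fls_nth_nth_eq_if_no_support) (use that in force)
  have zero_nth: "k \<noteq> 0 \<Longrightarrow> fls_nth (fls_nth b l) k = 0"
    if "\<forall>e \<in> support b. z_exponent e = 0" for b :: xyzt_series and k l
  proof -
    assume "k \<noteq> 0"
    then have "fls_nth (fls_nth b l) k = fls_nth (fls_nth 0 l) k"
      by (intro fls_nth_nth_eq_if_no_support) (use that in force)
    then show ?thesis by simp
  qed
  \<comment> \<open>In \<open>t\<close>-degree 0 the initial term excludes negative powers of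
    \<open>z\<close>, and the minus condition leaves only 1 among the others.\<close>
  have minus_0: "fls_nth b 0 = 1"
    if "has_initial_term b 1" "\<forall>e \<in> support (b - 1). z_exponent e < 0" for b :: xyzt_series
  proof (rule fls_eqI)
    fix k
    show "fls_nth (fls_nth b 0) k = fls_nth 1 k"
      using initial_term_one_fps(2)[OF that(1), of k] minus_nth[OF that(2), of k 0]
      by (cases "k < 0") auto
  qed
  have prod_props: "fls_nth (fps_nth (fls_regpart u * fls_regpart v) n) k = 0"
    if "k < 0" "\<forall>e \<in> support u. z_exponent e = 0" "\<forall>e \<in> support (v - 1). 0 < z_exponent e"
    for u v :: xyzt_series and n k
  proof -
    have "fls_nth (fls_nth v l) k = 0" if "k < 0" for l k
      using plus_nth[OF \<open>\<forall>e \<in> support (v - 1). 0 < z_exponent e\<close>, of k l] that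
      by (cases "l = 0") auto
    moreover have "fls_nth (fls_nth u l) k = 0" if "k < 0" for l k
      using zero_nth[OF \<open>\<forall>e \<in> support u. z_exponent e = 0\<close>, of k l] that by simp
    ultimately show ?thesis using \<open>k < 0\<close>
      by (auto simp: fps_mult_nth fls_nth_sum intro!: sum.neutral fls_mult_nth_below_zero(1))
  qed
  have ea: "a = fps_to_fls A" "c = fps_to_fls C" "p = fps_to_fls Q"
    "a' = fps_to_fls A'" "c' = fps_to_fls C'" "p' = fps_to_fls Q'"
    unfolding A_def C_def Q_def A'_def C'_def Q'_def
    using F(2-4) F'(2-4) by (simp_all flip: initial_term_one_fps(1))
  have "a * (c * p) = a' * (c' * p')" using F(1) F'(1) by (simp add: mult.assoc)
  then have "fps_to_fls (A * (C * Q)) = fps_to_fls (A' * (C' * Q'))"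
    by (simp only: ea fls_times_fps_to_fls)
  then have eq: "A * (C * Q) = A' * (C' * Q')" by simp
  have p0: "fls_nth (fls_nth p 0) 0 = 1" using plus_nth[OF F(7), of 0 0] by simp
  have c0: "fls_nth (fls_nth c 0) 0 \<noteq> 0" using F(3) by (rule initial_term_one_fps(3))
  have pneg: "k < 0 \<Longrightarrow> fls_nth (fls_nth p 0) k = 0" for k using plus_nth[OF F(7), of k 0] by simp
  have cneg: "k < 0 \<Longrightarrow> fls_nth (fls_nth c 0) k = 0" for k using zero_nth[OF F(6), of k 0] by simp
  have "A = A' \<and> C * Q = C' * Q'"
  proof (rule fps_fls_factorization_unique[OF eq])
    show "fps_nth A 0 = 1" "fps_nth A' 0 = 1"
      using minus_0[OF F(2,5)] minus_0[OF F'(2,5)] by (simp_all add: A_def A'_def)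
    show "fls_nth (fps_nth A n) k = 0" "fls_nth (fps_nth A' n) k = 0" if "0 < n" "0 \<le> k" for n k
      using minus_nth[OF F(5), of k "int n"] minus_nth[OF F'(5), of k "int n"] that
      by (simp_all add: A_def A'_def)
    show "fls_nth (fps_nth (C * Q) n) k = 0" "fls_nth (fps_nth (C' * Q') n) k = 0"
      if "k < 0" for n k
      unfolding C_def Q_def C'_def Q'_def
      using prod_props[OF that F(6,7)] prod_props[OF that F'(6,7)] by simp_all
    show "fls_nth (fps_nth (C * Q) 0) 0 \<noteq> 0"
      using fls_mult_nth_below_zero(2)[OF cneg pneg] p0 c0 by (simp add: C_def Q_def)
  qed
  moreover have "C = C' \<and> Q = Q'"
  proof (rule fps_fls_constant_factor_unique)
    show "C * Q = C' * Q'" using calculation by simp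
    show "C \<noteq> 0" using c0 ea(2) by auto
    show "fls_nth (fps_nth C n) k = 0" "fls_nth (fps_nth C' n) k = 0" if "k \<noteq> 0" for n k
      using zero_nth[OF F(6) that] zero_nth[OF F'(6) that] by (simp_all add: C_def C'_def)
    show "fls_nth (fps_nth Q n) k = fls_nth (fps_nth 1 n) k"
      "fls_nth (fps_nth Q' n) k = fls_nth (fps_nth 1 n) k" if "k \<le> 0" for n k
      using plus_nth[OF F(7) that] plus_nth[OF F'(7) that] by (simp_all add: Q_def Q'_def)
  qed
  ultimately show ?thesis by (simp add: fe fe' ea)
qed

section \<open>Decomposition of weighted words\<close>

text \<open>Both alternatives for a minus-path are covered: the empty word satisfies the condition
  vacuously, and a nonempty one has negative weight by comparison with its prefix
  \<open>[]\<close>.\<close>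

definition falling :: "('a \<Rightarrow> int) \<Rightarrow> 'a list \<Rightarrow> bool" where
  "falling f xs \<longleftrightarrow> (\<forall>ys. strict_prefix ys xs \<longrightarrow> sum_list (map f xs) < sum_list (map f ys))"

definition nonneg_prefixes :: "('a \<Rightarrow> int) \<Rightarrow> 'a list \<Rightarrow> bool" where
  "nonneg_prefixes f xs \<longleftrightarrow> (\<forall>ys. prefix ys xs \<longrightarrow> 0 \<le> sum_list (map f ys))"

definition pos_prefixes :: "('a \<Rightarrow> int) \<Rightarrow> 'a list \<Rightarrow> bool" where
  "pos_prefixes f xs \<longleftrightarrow> (\<forall>ys. prefix ys xs \<longrightarrow> ys \<noteq> [] \<longrightarrow> 0 < sum_list (map f ys))"

definition balanced :: "('a \<Rightarrow> int) \<Rightarrow> 'a list \<Rightarrow> bool" where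
  "balanced f xs \<longleftrightarrow> nonneg_prefixes f xs \<and> sum_list (map f xs) = 0"

text \<open>A letter is appended to \<open>u @ v\<close>. If the height relative to the end of
  \<open>u\<close> stays nonnegative, the letter joins \<open>v\<close>; otherwise the whole word
  reaches a new strict minimum and is falling.\<close>

lemma falling_nonneg_exists: "\<exists>u v. xs = u @ v \<and> falling f u \<and> nonneg_prefixes f v"
proof (induction xs rule: rev_induct)
  case Nil
  then show ?case by (simp add: falling_def nonneg_prefixes_def)
next
  case (snoc x xs)
  then obtain u v where uv: "xs = u @ v" "falling f u" "nonneg_prefixes f v" by blast
  show ?case
  proof (cases "0 \<le> sum_list (map f v) + f x")
    case True
    then have "nonneg_prefixes f (v @ [x])"
      using uv(3) by (auto simp: nonneg_prefixes_def)
    then show ?thesis using uv by (metis append.assoc)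
  next
    case False
    have "falling f (u @ v @ [x])"
      unfolding falling_def
    proof (intro allI impI)
      fix ys assume "strict_prefix ys (u @ v @ [x])"
      then have "prefix ys (u @ v)"
        by (metis append.assoc prefix_snoc strict_prefix_def)
      \<comment> \<open>In either case the weight of \<open>ys\<close> is at least that of
        \<open>u\<close>, which exceeds the new total.\<close>
      then consider "strict_prefix ys u" | vs where "ys = u @ vs" "prefix vs v"
        by (metis append_Nil2 prefix_append strict_prefix_def prefix_bot.bot_least)
      then show "sum_list (map f (u @ v @ [x])) < sum_list (map f ys)"
        using uv False by cases (fastforce simp: falling_def nonneg_prefixes_def)+
    qed
    moreover have "nonneg_prefixes f []" by (simp add: nonneg_prefixes_def)
    ultimately show ?thesis using uv(1) by (metis append.assoc append_Nil2)
  qed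
qed

text \<open>If the cuts differ, the piece between them ends a falling word and so has negative
  weight, but it also starts a word with nonnegative prefixes.\<close>

lemma falling_nonneg_unique:
  assumes "u @ v = u' @ v'" "falling f u" "falling f u'" "nonneg_prefixes f v" "nonneg_prefixes f v'"
  shows "u = u' \<and> v = v'"
proof -
  have *: "w = []" if "falling f (a @ w)" "nonneg_prefixes f (w @ b)" for a w b
  proof (rule ccontr)
    assume "w \<noteq> []"
    then have "strict_prefix a (a @ w)" by (simp add: strict_prefix_def)
    then have "sum_list (map f (a @ w)) < sum_list (map f a)" using that(1) unfolding falling_def by blast
    moreover have "0 \<le> sum_list (map f w)" using that(2) by (simp add: nonneg_prefixes_def)
    ultimately show False by simp
  qed
  obtain w where "u = u' @ w \<and> w @ v = v' \<or> u @ w = u' \<and> v = w @ v'"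
    using assms(1) unfolding append_eq_append_conv2 by blast
  then show ?thesis
  proof
    assume "u = u' @ w \<and> w @ v = v'"
    then show ?thesis using *[of u' w v] assms by simp
  next
    assume "u @ w = u' \<and> v = w @ v'"
    then show ?thesis using *[of u w v'] assms by auto
  qed
qed

text \<open>A letter that brings the height back to 0 makes the whole word balanced; any other
  letter extends the positive part.\<close>

lemma balanced_pos_exists:
  "nonneg_prefixes f xs \<Longrightarrow> \<exists>u v. xs = u @ v \<and> balanced f u \<and> pos_prefixes f v"
proof (induction xs rule: rev_induct)
  case Nil
  then show ?case by (simp add: balanced_def nonneg_prefixes_def pos_prefixes_def)
next
  case (snoc x xs)
  then have "nonneg_prefixes f xs" by (simp add: nonneg_prefixes_def)
  then obtain u v where uv: "xs = u @ v" "balanced f u" "pos_prefixes f v" using snoc by blast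
  have "0 \<le> sum_list (map f (xs @ [x]))" using snoc.prems unfolding nonneg_prefixes_def by blast
  \<comment> \<open>\<open>u\<close> has weight 0, so this is the height of the whole word.\<close>
  then have s: "0 \<le> sum_list (map f v) + f x" using uv by (simp add: balanced_def)
  show ?case
  proof (cases "sum_list (map f v) + f x = 0")
    case True
    then have "balanced f (xs @ [x])" using snoc.prems uv by (simp add: balanced_def)
    moreover have "pos_prefixes f []" by (simp add: pos_prefixes_def)
    ultimately show ?thesis by (metis append_Nil2)
  next
    case False
    then have "pos_prefixes f (v @ [x])" using s uv(3) by (auto simp: pos_prefixes_def)
    then show ?thesis using uv by (metis append.assoc)
  qed
qed

text \<open>The piece between two different cuts has weight 0, since it leads from one balanced word
  to another, yet it is a nonempty prefix of a positive word.\<close>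

lemma balanced_pos_unique:
  assumes "u @ v = u' @ v'" "balanced f u" "balanced f u'" "pos_prefixes f v" "pos_prefixes f v'"
  shows "u = u' \<and> v = v'"
proof -
  have *: "w = []" if "balanced f (a @ w)" "balanced f a" "pos_prefixes f (w @ b)" for a w b
  proof (rule ccontr)
    assume "w \<noteq> []"
    then have "0 < sum_list (map f w)" using that(3) by (simp add: pos_prefixes_def)
    then show False using that(1,2) by (simp add: balanced_def)
  qed
  obtain w where "u = u' @ w \<and> w @ v = v' \<or> u @ w = u' \<and> v = w @ v'"
    using assms(1) unfolding append_eq_append_conv2 by blast
  then show ?thesis
  proof
    assume "u = u' @ w \<and> w @ v = v'"
    then show ?thesis using *[of u' w v] assms by simp
  next
    assume "u @ w = u' \<and> v = w @ v'"
    then show ?thesis using *[of u w v'] assms by auto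
  qed
qed

lemma nonneg_prefixes_append:
  assumes "balanced f u" "pos_prefixes f v"
  shows "nonneg_prefixes f (u @ v)"
  unfolding nonneg_prefixes_def
proof (intro allI impI)
  fix ys assume "prefix ys (u @ v)"
  then consider "prefix ys u" | vs where "ys = u @ vs" "prefix vs v"
    by (auto simp: prefix_append)
  then show "0 \<le> sum_list (map f ys)"
  proof cases
    case 2
    then show ?thesis
      using assms by (cases "vs = []") (force simp: balanced_def pos_prefixes_def)+
  qed (use assms in \<open>auto simp: balanced_def nonneg_prefixes_def\<close>)
qed

section \<open>Paths as words in the primes\<close>

text \<open>Closure under products gives membership; a word in the primes is a factorization of its
  own concatenation, so uniqueness makes it the chosen one.\<close>

lemma free_monoid_concat:
  assumes "free_monoid H" "hs \<in> lists (prime_paths H)"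
  shows "concat hs \<in> H" "H_factorization H (concat hs) = hs"
proof -
  show c: "concat hs \<in> H"
    using assms(2) by induction (use assms(1) in \<open>auto simp: free_monoid_def prime_paths_def\<close>)
  have "\<exists>!hs'. is_prime_factorization H (concat hs) hs'"
    using assms(1) c by (auto simp: free_monoid_def)
  moreover have "is_prime_factorization H (concat hs) hs"
    using assms(2) by (auto simp: is_prime_factorization_def)
  ultimately show "H_factorization H (concat hs) = hs"
    unfolding H_factorization_def by (rule the1_equality)
qed

text \<open>Together with \<open>inj_on_concat_primes\<close> this identifies \<open>H\<close> with
  the words over its primes, so that heads become prefixes.\<close>

lemma free_monoid_eq_concat_image:
  assumes "free_monoid H"
  shows "H = concat ` lists (prime_paths H)"
proof (intro equalityI subsetI)
  fix \<sigma> assume "\<sigma> \<in> H"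
  then obtain hs where "is_prime_factorization H \<sigma> hs" using assms by (auto simp: free_monoid_def)
  then show "\<sigma> \<in> concat ` lists (prime_paths H)" by (auto simp: is_prime_factorization_def)
qed (use free_monoid_concat[OF assms] in auto)

lemma inj_on_concat_primes: "free_monoid H \<Longrightarrow> inj_on concat (lists (prime_paths H))"
  by (metis free_monoid_concat(2) inj_onI)

lemma heads_concat:
  assumes "free_monoid H" "hs \<in> lists (prime_paths H)"
  shows "heads H (concat hs) = concat ` {ys. prefix ys hs}"
  unfolding heads_def free_monoid_concat(2)[OF assms]
  by (auto simp: take_is_prefix) (metis append_eq_conv_conj image_eqI mem_Collect_eq prefixE prefix_length_le)

lemma gessel_pair_rho_concat:
  assumes "gessel_pair S H \<rho>" "hs \<in> lists (prime_paths H)"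
  shows "\<rho> (concat hs) = sum_list (map \<rho> hs)"
proof -
  have fm: "free_monoid H" and add: "\<And>u v. u \<in> H \<Longrightarrow> v \<in> H \<Longrightarrow> \<rho> (u @ v) = \<rho> u + \<rho> v"
    using assms(1) by (auto simp: gessel_pair_def)
  \<comment> \<open>Additivity at \<open>[] @ []\<close> says that \<rho> of the empty path equals
    its own double.\<close>
  have "\<rho> [] = 0" using add[of "[]" "[]"] fm by (simp add: free_monoid_def)
  show ?thesis
    using assms(2)
  proof induction
    case (Cons h hs)
    then show ?case
      using add[of h "concat hs"] free_monoid_concat(1)[OF fm] by (auto simp: prime_paths_def)
  qed (simp add: \<open>\<rho> [] = 0\<close>)
qed

section \<open>The three kinds of paths as conditions on words\<close>

context
  fixes S H \<rho>
  assumes gp: "gessel_pair S H \<rho>"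
begin

private lemma fm: "free_monoid H" using gp by (simp add: gessel_pair_def)

private lemma primes_prefix:
  "hs \<in> lists (prime_paths H) \<Longrightarrow> prefix ys hs \<Longrightarrow> ys \<in> lists (prime_paths H)"
  by (auto simp: prefix_def)

private lemma concat_primes_eq_iff:
  "hs \<in> lists (prime_paths H) \<Longrightarrow> hs' \<in> lists (prime_paths H) \<Longrightarrow> concat hs = concat hs' \<longleftrightarrow> hs = hs'"
  using inj_on_concat_primes[OF fm] by (auto dest: inj_onD)

private lemma concat_primes_eq_Nil_iff:
  "hs \<in> lists (prime_paths H) \<Longrightarrow> concat hs = [] \<longleftrightarrow> hs = []"
  using concat_primes_eq_iff[of hs "[]"] by simp

private lemma Collect_H_eq:
  assumes "\<And>hs. hs \<in> lists (prime_paths H) \<Longrightarrow> Q (concat hs) \<longleftrightarrow> R hs"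
  shows "{\<sigma> \<in> H. Q \<sigma>} = concat ` {hs \<in> lists (prime_paths H). R hs}"
proof -
  have "{\<sigma> \<in> H. Q \<sigma>} = {\<sigma> \<in> concat ` lists (prime_paths H). Q \<sigma>}"
    using free_monoid_eq_concat_image[OF fm] by simp
  also have "\<dots> = concat ` {hs \<in> lists (prime_paths H). R hs}" using assms by blast
  finally show ?thesis .
qed

text \<open>Since \<open>concat\<close> is injective on words in the primes, the heads other than
  the path itself come exactly from the strict prefixes.\<close>

lemma minus_paths_eq:
  "minus_paths H \<rho> = concat ` {hs \<in> lists (prime_paths H). falling \<rho> hs}"
  unfolding minus_paths_def
proof (rule Collect_H_eq)
  fix hs assume hs: "hs \<in> lists (prime_paths H)"
  have "heads H (concat hs) - {concat hs} = concat ` {ys. strict_prefix ys hs}"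
    using concat_primes_eq_iff[OF primes_prefix[OF hs] hs]
    by (auto simp: heads_concat[OF fm hs] strict_prefix_def)
  then have "(\<forall>\<tau> \<in> heads H (concat hs) - {concat hs}. \<rho> (concat hs) < \<rho> \<tau>) \<longleftrightarrow> falling \<rho> hs"
    using gessel_pair_rho_concat[OF gp] hs primes_prefix[OF hs]
    by (simp add: falling_def strict_prefix_def)
  moreover have "falling \<rho> hs \<Longrightarrow> hs = [] \<or> \<rho> (concat hs) < 0"
    using gessel_pair_rho_concat[OF gp hs] unfolding falling_def strict_prefix_def
    by (metis list.map(1) prefix_bot.bot_least sum_list.Nil)
  moreover have "falling \<rho> []" by (simp add: falling_def)
  ultimately show "(concat hs = [] \<or> \<rho> (concat hs) < 0 \<and>
      (\<forall>\<tau> \<in> heads H (concat hs) - {concat hs}. \<rho> (concat hs) < \<rho> \<tau>)) \<longleftrightarrow> falling \<rho> hs"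
    using concat_primes_eq_Nil_iff[OF hs] by auto
qed

lemma zero_paths_eq:
  "zero_paths H \<rho> = concat ` {hs \<in> lists (prime_paths H). balanced \<rho> hs}"
  unfolding zero_paths_def
proof (rule Collect_H_eq)
  fix hs assume hs: "hs \<in> lists (prime_paths H)"
  show "(\<rho> (concat hs) = 0 \<and> (\<forall>\<tau> \<in> heads H (concat hs). 0 \<le> \<rho> \<tau>)) \<longleftrightarrow> balanced \<rho> hs"
    using gessel_pair_rho_concat[OF gp] hs primes_prefix[OF hs]
    by (auto simp: balanced_def nonneg_prefixes_def heads_concat[OF fm hs])
qed

lemma plus_paths_eq:
  "plus_paths H \<rho> = concat ` {hs \<in> lists (prime_paths H). pos_prefixes \<rho> hs}"
  unfolding plus_paths_def
proof (rule Collect_H_eq)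
  fix hs assume hs: "hs \<in> lists (prime_paths H)"
  show "(\<forall>\<tau> \<in> heads H (concat hs). \<tau> \<noteq> [] \<longrightarrow> 0 < \<rho> \<tau>) \<longleftrightarrow> pos_prefixes \<rho> hs"
    using gessel_pair_rho_concat[OF gp] hs primes_prefix[OF hs] concat_primes_eq_Nil_iff
    by (auto simp: pos_prefixes_def heads_concat[OF fm hs] simp del: concat_eq_Nil_conv)
qed

text \<open>Transfers a unique factorization of words to paths. It serves both cuts: at the first
  minimum, and at the last return to it.\<close>

lemma bij_betw_append_concat:
  assumes uniq: "\<And>u v u' v'. u @ v = u' @ v' \<Longrightarrow> A u \<Longrightarrow> A u' \<Longrightarrow> B v \<Longrightarrow> B v' \<Longrightarrow> u = u' \<and> v = v'"
    and ex: "\<And>w. C w \<Longrightarrow> \<exists>u v. w = u @ v \<and> A u \<and> B v"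
    and app: "\<And>u v. A u \<Longrightarrow> B v \<Longrightarrow> C (u @ v)"
  shows "bij_betw (\<lambda>(u, v). u @ v)
    (concat ` {hs \<in> lists (prime_paths H). A hs} \<times> concat ` {hs \<in> lists (prime_paths H). B hs})
    (concat ` {hs \<in> lists (prime_paths H). C hs})"
    (is "bij_betw _ (?A \<times> ?B) ?C")
proof (rule bij_betw_imageI)
  show "inj_on (\<lambda>(u, v). u @ v) (?A \<times> ?B)"
  proof (rule inj_onI, clarsimp simp flip: concat_append)
    fix u v u' v'
    assume *: "A u" "A u'" "B v" "B v'" "concat (u @ v) = concat (u' @ v')"
      "\<forall>x\<in>set u. x \<in> prime_paths H" "\<forall>x\<in>set v. x \<in> prime_paths H"
      "\<forall>x\<in>set u'. x \<in> prime_paths H" "\<forall>x\<in>set v'. x \<in> prime_paths H"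
    then have "u @ v = u' @ v'"
      using concat_primes_eq_iff[of "u @ v" "u' @ v'"] by auto
    then show "concat u = concat u' \<and> concat v = concat v'" using uniq * by blast
  qed
  show "(\<lambda>(u, v). u @ v) ` (?A \<times> ?B) = ?C"
  proof (intro equalityI subsetI)
    fix \<sigma> assume "\<sigma> \<in> (\<lambda>(u, v). u @ v) ` (?A \<times> ?B)"
    then obtain u v where "u \<in> lists (prime_paths H)" "v \<in> lists (prime_paths H)" "A u" "B v"
      "\<sigma> = concat (u @ v)" by auto
    then show "\<sigma> \<in> ?C" using app by (intro image_eqI[of _ _ "u @ v"]) auto
  next
    fix \<sigma> assume "\<sigma> \<in> ?C"
    then obtain w where w: "w \<in> lists (prime_paths H)" "C w" "\<sigma> = concat w" by blast
    then obtain u v where uv: "w = u @ v" "A u" "B v" using ex by blast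
    then show "\<sigma> \<in> (\<lambda>(u, v). u @ v) ` (?A \<times> ?B)"
      using w by (intro image_eqI[of _ _ "(concat u, concat v)"]) auto
  qed
qed

end

section \<open>Generating functions\<close>

text \<open>Weights multiply and lengths add under concatenation, so sorting the pairs by the length
  of the first path turns the sum over \<open>C\<close> into a Cauchy product in
  \<open>t\<close>.\<close>

lemma generating_function_mult:
  assumes "finite S" and sub: "A \<subseteq> lists S" "B \<subseteq> lists S"
    and bij: "bij_betw (\<lambda>(u, v). u @ v) (A \<times> B) C"
    and add: "\<And>u v. u \<in> A \<Longrightarrow> v \<in> B \<Longrightarrow> \<rho> (u @ v) = \<rho> u + \<rho> v"
  shows "generating_function \<rho> C = generating_function \<rho> A * generating_function \<rho> B"
proof -
  define w :: "path \<Rightarrow> xyz_series" where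
    "w \<pi> = var_x powi fst (ending_point \<pi>) * var_y powi snd (ending_point \<pi>) * var_z powi \<rho> \<pi>" for \<pi>
  define L where "L P n = {\<pi> \<in> P. length \<pi> = n}" for P :: "path set" and n
  define G where "G P = Abs_fps (\<lambda>n. \<Sum>\<pi>\<in>L P n. w \<pi>)" for P
  have gf: "generating_function \<rho> P = fps_to_fls (G P)" for P
    by (simp add: generating_function_def G_def L_def w_def)
  \<comment> \<open>Exponents may be negative, so splitting \<open>powi\<close> over a sum uses
    nonzero bases.\<close>
  have nz: "var_x \<noteq> 0" "var_y \<noteq> 0" "var_z \<noteq> 0"
    by (simp_all add: var_x_def var_y_def var_z_def)
  have w_mult: "w (u @ v) = w u * w v" if "u \<in> A" "v \<in> B" for u v
    using add[OF that] nz by (simp add: w_def ending_point_def power_int_add mult_ac)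
  have fin: "finite (L A n)" "finite (L B n)" for n
    unfolding L_def using finite_paths_of_length assms by blast+
  have "fps_nth (G C) n = fps_nth (G A * G B) n" for n
  proof -
    define D where "D = {p \<in> A \<times> B. length (fst p) + length (snd p) = n}"
    have D: "D = (\<Union>i\<in>{0..n}. L A i \<times> L B (n - i))"
      by (auto simp: D_def L_def)
    have "bij_betw (\<lambda>(u, v). u @ v) D (L C n)"
    proof (rule bij_betw_subset[OF bij])
      have C: "C = (\<lambda>(u, v). u @ v) ` (A \<times> B)" using bij by (simp add: bij_betw_def)
      show "(\<lambda>(u, v). u @ v) ` D = L C n"
        unfolding C by (force simp: D_def L_def)
    qed (auto simp: D_def)
    then have "fps_nth (G C) n = (\<Sum>p\<in>D. w (case p of (u, v) \<Rightarrow> u @ v))"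
      unfolding G_def by (simp add: sum.reindex_bij_betw)
    also have "\<dots> = (\<Sum>p\<in>D. case p of (u, v) \<Rightarrow> w u * w v)"
      by (rule sum.cong) (auto simp: D_def w_mult)
    also have "\<dots> = (\<Sum>i=0..n. \<Sum>p\<in>L A i \<times> L B (n - i). case p of (u, v) \<Rightarrow> w u * w v)"
      unfolding D by (rule sum.UNION_disjoint) (use fin in \<open>auto simp: L_def\<close>)
    also have "\<dots> = fps_nth (G A * G B) n"
      by (simp add: fps_mult_nth G_def sum_product sum.cartesian_product)
    finally show ?thesis .
  qed
  then have "G C = G A * G B" by (rule fps_ext)
  then show ?thesis by (simp add: gf fls_times_fps_to_fls)
qed

section \<open>Supports and initial terms of generating functions\<close>

lemma support_generating_function:
  assumes "finite S" "P \<subseteq> lists S" "(i, j, k, l) \<in> support (generating_function \<rho> P)"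
  obtains \<pi> where "\<pi> \<in> P" "ending_point \<pi> = (i, j)" "\<rho> \<pi> = k" "int (length \<pi>) = l"
proof -
  let ?X = "{\<pi> \<in> P. ending_point \<pi> = (i, j) \<and> \<rho> \<pi> = k \<and> int (length \<pi>) = l}"
  have "(of_nat (card ?X) :: complex) \<noteq> 0"
    using assms(3) unfolding support_def mem_Collect_eq coeff_generating_function[OF assms(1,2)] .
  then have "?X \<noteq> {}" by (metis card.empty of_nat_0)
  then show thesis using that by blast
qed

lemma series_coeff_generating_function_zero:
  assumes "finite S" "P \<subseteq> lists S" "[] \<in> P" "\<rho> [] = 0"
  shows "series_coeff (generating_function \<rho> P) (0, 0, 0, 0) = 1"
proof -
  have "{\<pi> \<in> P. ending_point \<pi> = (0, 0) \<and> \<rho> \<pi> = 0 \<and> int (length \<pi>) = 0} = {[]}"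
    using assms by (auto simp: ending_point_def zero_prod_def)
  then show ?thesis using coeff_generating_function[OF assms(1,2)] by simp
qed

text \<open>A nonempty path has positive length, and a positive \<open>t\<close>-exponent dominates
  the order whatever the signs of the other exponents.\<close>

lemma has_initial_term_generating_function:
  assumes "finite S" "P \<subseteq> lists S" "[] \<in> P" "\<rho> [] = 0"
  shows "has_initial_term (generating_function \<rho> P) 1"
  unfolding has_initial_term_one_iff
proof (intro conjI allI impI)
  fix e assume nz: "series_coeff (generating_function \<rho> P) e \<noteq> 0"
  obtain i j k l where e: "e = (i, j, k, l)" by (cases e)
  have "(i, j, k, l) \<in> support (generating_function \<rho> P)"
    using nz unfolding support_def e by blast
  then obtain \<pi> where "\<pi> \<in> P" "ending_point \<pi> = (i, j)" "\<rho> \<pi> = k" "int (length \<pi>) = l"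
    by (rule support_generating_function[OF assms(1,2)])
  then show "revlex_le (0, 0, 0, 0) e"
    using assms(4) by (cases "\<pi> = []") (auto simp: e ending_point_def zero_prod_def)
qed (rule series_coeff_generating_function_zero[where \<rho> = \<rho>, OF assms])

text \<open>Subtracting 1 cancels exactly the contribution of the empty path, the only path of
  length 0.\<close>

lemma support_generating_function_minus_one:
  assumes "finite S" "P \<subseteq> lists S" "[] \<in> P" "\<rho> [] = 0"
    and "e \<in> support (generating_function \<rho> P - 1)"
  obtains \<pi> where "\<pi> \<in> P" "\<pi> \<noteq> []" "\<rho> \<pi> = z_exponent e"
proof -
  obtain i j k l where e: "e = (i, j, k, l)" by (cases e)
  have ne: "e \<noteq> (0, 0, 0, 0)"
    using assms(5) series_coeff_generating_function_zero[where \<rho> = \<rho>, OF assms(1-4)]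
    by (auto simp: support_def series_coeff_diff series_coeff_one simp del: series_coeff.simps)
  then have "(i, j, k, l) \<in> support (generating_function \<rho> P)"
    using assms(5) by (auto simp: support_def series_coeff_diff series_coeff_one e
        simp del: series_coeff.simps)
  then obtain \<pi> where \<pi>: "\<pi> \<in> P" "ending_point \<pi> = (i, j)" "\<rho> \<pi> = k" "int (length \<pi>) = l"
    by (rule support_generating_function[OF assms(1,2)])
  moreover have "\<pi> \<noteq> []" using \<pi> ne assms(4) by (auto simp: e ending_point_def zero_prod_def)
  ultimately show ?thesis using that e by simp
qed

lemma is_z_factorization_generating_function:
  assumes fin: "finite S" and gp: "gessel_pair S H \<rho>"
  shows "is_z_factorization (generating_function \<rho> H)
    (generating_function \<rho> (minus_paths H \<rho>), generating_function \<rho> (zero_paths H \<rho>),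
     generating_function \<rho> (plus_paths H \<rho>))"
proof -
  \<comment> \<open>\<open>N\<close> holds the paths without heads of negative \<rho>; it is what
    remains after the minus-path and splits further into a zero- and a plus-path.\<close>
  define N where "N = concat ` {hs \<in> lists (prime_paths H). nonneg_prefixes \<rho> hs}"
  have fm: "free_monoid H" and HS: "H \<subseteq> lists S"
    and add: "\<And>u v. u \<in> H \<Longrightarrow> v \<in> H \<Longrightarrow> \<rho> (u @ v) = \<rho> u + \<rho> v"
    using gp by (auto simp: gessel_pair_def)
  have nil: "[] \<in> H" using fm by (simp add: free_monoid_def)
  have rho0: "\<rho> [] = 0" using add[OF nil nil] by simp
  have NH: "N \<subseteq> H" using free_monoid_concat(1)[OF fm] by (auto simp: N_def)
  have sub: "minus_paths H \<rho> \<subseteq> H" "zero_paths H \<rho> \<subseteq> H" "plus_paths H \<rho> \<subseteq> H"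
    by (auto simp: minus_paths_def zero_paths_def plus_paths_def)
  have nils: "[] \<in> minus_paths H \<rho>" "[] \<in> zero_paths H \<rho>" "[] \<in> plus_paths H \<rho>"
    using nil rho0 heads_concat[OF fm, of "[]"]
    by (auto simp: minus_paths_def zero_paths_def plus_paths_def)
  have subS: "minus_paths H \<rho> \<subseteq> lists S" "zero_paths H \<rho> \<subseteq> lists S" "plus_paths H \<rho> \<subseteq> lists S"
    "N \<subseteq> lists S"
    using sub NH HS by blast+
  \<comment> \<open>Every word has a first cut, so the condition on the product is
    \<open>True\<close> and its paths make up all of \<open>H\<close>.\<close>
  have "bij_betw (\<lambda>(u, v). u @ v) (minus_paths H \<rho> \<times> N)
      (concat ` {hs \<in> lists (prime_paths H). True})"
    unfolding minus_paths_eq[OF gp] N_def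
    by (rule bij_betw_append_concat[OF gp])
      (use falling_nonneg_unique falling_nonneg_exists in blast)+
  then have "bij_betw (\<lambda>(u, v). u @ v) (minus_paths H \<rho> \<times> N) H"
    using free_monoid_eq_concat_image[OF fm] by simp
  then have 1: "generating_function \<rho> H =
      generating_function \<rho> (minus_paths H \<rho>) * generating_function \<rho> N"
    by (rule generating_function_mult[OF fin subS(1,4)]) (use add sub NH in blast)
  have "bij_betw (\<lambda>(u, v). u @ v) (zero_paths H \<rho> \<times> plus_paths H \<rho>) N"
    unfolding zero_paths_eq[OF gp] plus_paths_eq[OF gp] N_def
    by (rule bij_betw_append_concat[OF gp])
      (use balanced_pos_unique balanced_pos_exists nonneg_prefixes_append in blast)+
  then have 2: "generating_function \<rho> N =
      generating_function \<rho> (zero_paths H \<rho>) * generating_function \<rho> (plus_paths H \<rho>)"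
    by (rule generating_function_mult[OF fin subS(2,3)]) (use add sub in blast)
  have "z_exponent e < 0" if "e \<in> support (generating_function \<rho> (minus_paths H \<rho>) - 1)" for e
    by (rule support_generating_function_minus_one[where \<rho> = \<rho>, OF fin subS(1) nils(1) rho0 that])
      (auto simp: minus_paths_def)
  moreover have "0 < z_exponent e"
    if e: "e \<in> support (generating_function \<rho> (plus_paths H \<rho>) - 1)" for e
  proof -
    obtain \<pi> where \<pi>: "\<pi> \<in> plus_paths H \<rho>" "\<pi> \<noteq> []" "\<rho> \<pi> = z_exponent e"
      using support_generating_function_minus_one[where \<rho> = \<rho>, OF fin subS(3) nils(3) rho0 e] .
    then obtain hs where hs: "hs \<in> lists (prime_paths H)" "\<pi> = concat hs"
      using sub free_monoid_eq_concat_image[OF fm] by blast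
    \<comment> \<open>The plus condition speaks about heads only; it reaches the path because the
      path is its own last head.\<close>
    then have "\<pi> \<in> heads H \<pi>" using heads_concat[OF fm hs(1)] by auto
    then show ?thesis using \<pi> by (auto simp: plus_paths_def)
  qed
  moreover have "z_exponent e = 0" if e: "e \<in> support (generating_function \<rho> (zero_paths H \<rho>))" for e
  proof -
    obtain i j k l where ijkl: "e = (i, j, k, l)" by (cases e)
    show ?thesis
      by (rule support_generating_function[OF fin subS(2) e[unfolded ijkl]])
        (auto simp: zero_paths_def ijkl)
  qed
  ultimately show ?thesis
    using 1 2 has_initial_term_generating_function[where \<rho> = \<rho>, OF fin subS(1) nils(1) rho0]
      has_initial_term_generating_function[where \<rho> = \<rho>, OF fin subS(2) nils(2) rho0]
      has_initial_term_generating_function[where \<rho> = \<rho>, OF fin subS(3) nils(3) rho0]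
    by (simp add: is_z_factorization_def mult.assoc)
qed

theorem theorem3p3:
  fixes S :: "(int \<times> int) set" and H :: "path set" and \<rho> :: "path \<Rightarrow> int"
  assumes "finite S" and "gessel_pair S H \<rho>"
  shows "(\<exists>!f. is_z_factorization (generating_function \<rho> H) f) \<and>
    generating_function \<rho> H =
      minus_factor (generating_function \<rho> H) * zero_factor (generating_function \<rho> H) *
      plus_factor (generating_function \<rho> H) \<and>
    generating_function \<rho> (minus_paths H \<rho>) = minus_factor (generating_function \<rho> H) \<and>
    generating_function \<rho> (zero_paths H \<rho>) = zero_factor (generating_function \<rho> H) \<and>
    generating_function \<rho> (plus_paths H \<rho>) = plus_factor (generating_function \<rho> H)"
proof -
  let ?F = "(generating_function \<rho> (minus_paths H \<rho>), generating_function \<rho> (zero_paths H \<rho>),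
    generating_function \<rho> (plus_paths H \<rho>))"
  have F: "is_z_factorization (generating_function \<rho> H) ?F"
    by (rule is_z_factorization_generating_function[OF assms])
  have ex1: "\<exists>!f. is_z_factorization (generating_function \<rho> H) f"
    using F z_factorization_unique by blast
  then have "z_factorization (generating_function \<rho> H) = ?F"
    unfolding z_factorization_def using F by (rule the1_equality)
  then show ?thesis
    using ex1 F by (simp add: minus_factor_def zero_factor_def plus_factor_def is_z_factorization_def)
qed

end
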